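(* Let $(S_n,n\ge0)$ be the process on $\mathbb{Z}$ starting from $0$ which at a first visit to a site makes a discrete symmetric Cauchy jump and at other visits makes a $\pm1$ Bernoulli jump. Then $$\frac1n\sup_{t\le n}|S_t|\to0\quad\text{in probability as } n\to\infty.$$
   Context: The discrete symmetric Cauchy law $P_2$ is the law on $\mathbb{Z}$ of the first return position to the horizontal axis of simple random walk on $\mathbb{Z}^2$: if $(U,V)$ is simple random walk on $\mathbb{Z}^2$ (steps $(\pm1,0),(0,\pm1)$ with probability $1/4$ each) started at $(0,0)$ and $T=\inf\{n>0: V(n)=0\}$, then $P_2$ is the law of $U_T$. A $\pm1$ Bernoulli jump has law $P_1$ with $P_1(1)=P_1(-1)=1/2$. Precisely, $S_0=0$ and for every $n\ge0$ the conditional law of $S_{n+1}-S_n$ given $S_0,\dots,S_n$ is $P_2$ if $S_n\notin\{S_0,\dots,S_{n-1}\}$ and $P_1$ otherwise. *)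

theory Defs
  imports "HOL-Probability.Probability"
begin

definition srw_step :: "(int \<times> int) pmf" where
  "srw_step = pmf_of_set {(1, 0), (-1, 0), (0, 1), (0, -1)}"

text \<open>Sample space of simple random walk on the square lattice: sequences of i.i.d. steps.\<close>

definition srw_steps :: "(nat \<Rightarrow> int \<times> int) measure" where
  "srw_steps = (\<Pi>\<^sub>M i\<in>UNIV. measure_pmf srw_step)"

definition srw_U :: "(nat \<Rightarrow> int \<times> int) \<Rightarrow> nat \<Rightarrow> int" where
  "srw_U \<omega> n = (\<Sum>k<n. fst (\<omega> k))"

definition srw_V :: "(nat \<Rightarrow> int \<times> int) \<Rightarrow> nat \<Rightarrow> int" where
  "srw_V \<omega> n = (\<Sum>k<n. snd (\<omega> k))"

text \<open>The infimum is taken in \<^typ>\<open>nat\<close>, so it is 0 on the null event that the walk never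
  returns to the axis.\<close>

definition srw_return_time :: "(nat \<Rightarrow> int \<times> int) \<Rightarrow> nat" where
  "srw_return_time \<omega> = Inf {n. 0 < n \<and> srw_V \<omega> n = 0}"

text \<open>The discrete symmetric Cauchy law.\<close>

definition P2 :: "int measure" where
  "P2 = distr srw_steps (count_space UNIV) (\<lambda>\<omega>. srw_U \<omega> (srw_return_time \<omega>))"

definition P1 :: "int measure" where
  "P1 = measure_pmf (pmf_of_set {1, -1})"

text \<open>As the process is integer-valued, its conditional law given the past is expressed by
  elementary conditioning on every past trajectory of positive probability.\<close>

definition cauchy_bernoulli_process :: "'a measure \<Rightarrow> (nat \<Rightarrow> 'a \<Rightarrow> int) \<Rightarrow> bool" where
  "cauchy_bernoulli_process M S \<longleftrightarrow>
     prob_space M \<and>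
     (\<forall>n. S n \<in> measurable M (count_space UNIV)) \<and>
     (AE \<omega> in M. S 0 \<omega> = 0) \<and>
     (\<forall>n (x :: nat \<Rightarrow> int). \<P>(\<omega> in M. \<forall>i\<le>n. S i \<omega> = x i) > 0 \<longrightarrow>
        (\<forall>A. \<P>(\<omega> in M. S (Suc n) \<omega> - S n \<omega> \<in> A \<bar> \<forall>i\<le>n. S i \<omega> = x i) =
               measure (if x n \<notin> x ` {..<n} then P2 else P1) A))"

definition tendsto_in_probability ::
    "'a measure \<Rightarrow> (nat \<Rightarrow> 'a \<Rightarrow> real) \<Rightarrow> ('a \<Rightarrow> real) \<Rightarrow> bool" where
  "tendsto_in_probability M X Y \<longleftrightarrow>
     (\<forall>\<epsilon>>0. (\<lambda>n. \<P>(\<omega> in M. \<bar>X n \<omega> - Y \<omega>\<bar> > \<epsilon>)) \<longlonglongrightarrow> 0)"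

text \<open>The position at the return time is measurable, so \<^const>\<open>P2\<close> is a genuine push-forward.\<close>

lemma measurable_srw_return_position [measurable]:
  "(\<lambda>\<omega>. srw_U \<omega> (srw_return_time \<omega>)) \<in> measurable srw_steps (count_space UNIV)"
proof -
  have c: "(\<lambda>\<omega>. \<omega> k) \<in> measurable srw_steps (count_space UNIV)" for k
    using measurable_component_singleton[of k UNIV "\<lambda>_. measure_pmf srw_step"]
    by (simp add: srw_steps_def)
  have f [measurable]: "(\<lambda>\<omega>. fst (\<omega> k)) \<in> measurable srw_steps (count_space UNIV)"
    and s [measurable]: "(\<lambda>\<omega>. snd (\<omega> k)) \<in> measurable srw_steps (count_space UNIV)" for k
    by (rule measurable_compose[OF c], simp)+
  have U [measurable]: "(\<lambda>\<omega>. srw_U \<omega> n) \<in> measurable srw_steps (count_space UNIV)" for n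
    unfolding srw_U_def by (induction n) simp_all
  have V [measurable]: "(\<lambda>\<omega>. srw_V \<omega> n) \<in> measurable srw_steps (count_space UNIV)" for n
    unfolding srw_V_def by (induction n) simp_all
  have T [measurable]: "srw_return_time \<in> measurable srw_steps (count_space UNIV)"
    unfolding srw_return_time_def Inf_nat_def by measurable
  show ?thesis
    by (rule measurable_compose_countable[OF U T])
qed

lemma prob_space_P2: "prob_space P2"
proof -
  interpret prob_space srw_steps
    unfolding srw_steps_def by (intro prob_space_PiM prob_space_measure_pmf)
  show ?thesis
    unfolding P2_def by (rule prob_space_distr) measurable
qed

end

theory Submission
  imports Defs
begin

text \<open>
  The Cauchy law is the harmonic measure of planar random walk on the axis, so a function of two
  variables that is superharmonic off the axis controls the effect of a Cauchy jump
  (\<open>nn_integral_P2_le\<close>). The functions used are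
  $\ln (x^2 + (|y| + B)^2 - 1/2)$, which are superharmonic off the axis by an exact algebraic identity
  (\<open>neighbour_product_le\<close>). On the axis they are essentially $\ln (x^2 + B^2)$, and a Cauchy jump from
  \<open>x\<close> increases them on average by at most $(B + 2) / (x^2 + B^2 - 1/2)$, a Bernoulli jump by at most
  $2 / (x^2 + B^2 - 1/2)$. Both steps of the proof use this family, at different scales.

  For $B = 1$ the increments are summable over the line. Let the potential of the range be the sum of
  $\ln (1 + 2 (S_n - y)^2)$ over all sites \<open>y\<close> visited up to time \<open>n\<close>. The sites being distinct, its
  expectation increases by at most a constant in each step, whichever law the jump has. Since the
  logarithm tends to infinity, a range of positive density would force the potential to grow faster than
  linearly. Hence the expected number of visited sites, and with it the expected number of Cauchy jumps, is
  \<open>o(n)\<close> (\<open>expected_range_sublinear\<close>).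

  For $B = \<epsilon> n$ a Cauchy jump increases the function on average by $O(1/B)$ and a Bernoulli jump by
  $O(1/B^2)$, while outside $(-B, B)$ the normalised function is at least $\ln 2$. So the probability
  of leaving $(-B, B)$ by time \<open>n\<close> is $O(n / B^2)$ plus $O(1/B)$ times the expected number
  of Cauchy jumps (\<open>exit_probability\<close>), and this tends to zero.
\<close>


section \<open>First-step analysis of the planar walk\<close>

definition unit_steps :: "(int \<times> int) set" where
  "unit_steps = {(1, 0), (-1, 0), (0, 1), (0, -1)}"

lemma space_srw_steps [simp]: "space srw_steps = UNIV"
  by (simp add: srw_steps_def space_PiM)

lemma prob_space_srw_steps: "prob_space srw_steps"
  unfolding srw_steps_def by (intro prob_space_PiM prob_space_measure_pmf)

lemma measurable_srw_coordinates [measurable]: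
  "(\<lambda>\<omega>. srw_U \<omega> n) \<in> measurable srw_steps (count_space UNIV)"
  "(\<lambda>\<omega>. srw_V \<omega> n) \<in> measurable srw_steps (count_space UNIV)"
proof -
  have c: "(\<lambda>\<omega>. \<omega> k) \<in> measurable srw_steps (count_space UNIV)" for k
    using measurable_component_singleton[of k UNIV "\<lambda>_. measure_pmf srw_step"]
    by (simp add: srw_steps_def)
  have [measurable]: "(\<lambda>\<omega>. fst (\<omega> k)) \<in> measurable srw_steps (count_space UNIV)"
    "(\<lambda>\<omega>. snd (\<omega> k)) \<in> measurable srw_steps (count_space UNIV)" for k
    by (rule measurable_compose[OF c], simp)+
  show "(\<lambda>\<omega>. srw_U \<omega> n) \<in> measurable srw_steps (count_space UNIV)"
    unfolding srw_U_def by (induction n) simp_all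
  show "(\<lambda>\<omega>. srw_V \<omega> n) \<in> measurable srw_steps (count_space UNIV)"
    unfolding srw_V_def by (induction n) simp_all
qed

lemma srw_coordinates_case_nat:
  "srw_U (case_nat s \<omega>) (Suc n) = fst s + srw_U \<omega> n"
  "srw_V (case_nat s \<omega>) (Suc n) = snd s + srw_V \<omega> n"
  unfolding srw_U_def srw_V_def by (subst sum.lessThan_Suc_shift, simp)+

lemma srw_coordinates_0 [simp]: "srw_U \<omega> 0 = 0" "srw_V \<omega> 0 = 0"
  by (simp_all add: srw_U_def srw_V_def)

text \<open>The Markov property at time one; every later statement about the planar walk is obtained from it,
  by solving a recursion in the starting point.\<close>
lemma nn_integral_first_step:
  assumes [measurable]: "F \<in> borel_measurable srw_steps"
  shows "(\<integral>\<^sup>+\<omega>. F \<omega> \<partial>srw_steps) =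
         (\<Sum>s\<in>unit_steps. \<integral>\<^sup>+\<omega>. F (case_nat s \<omega>) \<partial>srw_steps) / 4"
proof -
  interpret sequence_space "measure_pmf srw_step"
    by standard
  interpret S: prob_space srw_steps by (rule prob_space_srw_steps)
  have S: "S = srw_steps" by (simp add: srw_steps_def)
  have F [measurable]: "F \<in> borel_measurable S" by (simp add: S)
  have "(\<integral>\<^sup>+\<omega>. F \<omega> \<partial>srw_steps) = (\<integral>\<^sup>+\<omega>. F \<omega> \<partial>S)"
    by (simp add: S)
  also have "\<dots> = (\<integral>\<^sup>+X. F ((\<lambda>(s, \<omega>). case_nat s \<omega>) X) \<partial>(measure_pmf srw_step \<Otimes>\<^sub>M S))"
    by (subst PiM_iter[symmetric]) (simp add: nn_integral_distr)
  also have "\<dots> = (\<integral>\<^sup>+s. \<integral>\<^sup>+\<omega>. F ((\<lambda>(s, \<omega>). case_nat s \<omega>) (s, \<omega>)) \<partial>S \<partial>measure_pmf srw_step)"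
    by (subst nn_integral_fst) simp_all
  also have "\<dots> = (\<integral>\<^sup>+s. \<integral>\<^sup>+\<omega>. F (case_nat s \<omega>) \<partial>srw_steps \<partial>measure_pmf srw_step)"
    by (simp add: S)
  also have "\<dots> = (\<Sum>s\<in>unit_steps. \<integral>\<^sup>+\<omega>. F (case_nat s \<omega>) \<partial>srw_steps) / 4"
    unfolding srw_step_def unit_steps_def
    by (subst nn_integral_pmf_of_set) auto
  finally show ?thesis .
qed

lemma all_nat_split: "(\<forall>n. P n) \<longleftrightarrow> P 0 \<and> (\<forall>n. P (Suc n))"
  by (metis not0_implies_Suc)

definition avoid :: "int \<Rightarrow> (nat \<Rightarrow> int \<times> int) set" where
  "avoid y = {\<omega>. \<forall>n. y + srw_V \<omega> n \<noteq> 0}"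

lemma avoid_in_sets [measurable]: "avoid y \<in> sets srw_steps"
proof -
  have "{\<omega>\<in>space srw_steps. \<forall>n. y + srw_V \<omega> n \<noteq> 0} \<in> sets srw_steps" by measurable
  then show ?thesis by (simp add: avoid_def)
qed

lemma case_nat_in_avoid_iff:
  "y \<noteq> 0 \<Longrightarrow> case_nat s \<omega> \<in> avoid y \<longleftrightarrow> \<omega> \<in> avoid (y + snd s)"
proof -
  assume "y \<noteq> 0"
  then have "case_nat s \<omega> \<in> avoid y \<longleftrightarrow> (\<forall>n. y + srw_V (case_nat s \<omega>) (Suc n) \<noteq> 0)"
    unfolding avoid_def mem_Collect_eq by (subst all_nat_split) simp
  then show ?thesis
    by (simp add: avoid_def srw_coordinates_case_nat add.assoc)
qed

lemma linear_of_second_difference_zero: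
  fixes u :: "nat \<Rightarrow> real"
  assumes "u 0 = 0" and "\<And>n. u (Suc (Suc n)) - u (Suc n) = u (Suc n) - u n"
  shows "u n = real n * u 1"
proof -
  define d where "d = u 1"
  have diff: "u (Suc n) - u n = d" for n
    by (induction n) (use assms in \<open>simp_all add: d_def\<close>)
  have "u n = real n * d"
  proof (induction n)
    case (Suc n)
    then show ?case using diff[of n] by (simp add: algebra_simps)
  qed (simp add: assms(1))
  then show ?thesis by (simp add: d_def)
qed

text \<open>Recurrence of the vertical coordinate. The probability of never reaching height zero is harmonic
  off height zero and vanishes there, hence is linear on each half-line; being bounded, it is zero.\<close>
lemma measure_avoid: "measure srw_steps (avoid y) = 0"
proof -
  interpret S: prob_space srw_steps by (rule prob_space_srw_steps)
  define v where "v y = measure srw_steps (avoid y)" for y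
  have v0: "v 0 = 0"
  proof -
    have "avoid 0 = {}" by (auto simp: avoid_def intro!: exI[of _ 0])
    then show ?thesis by (simp add: v_def)
  qed
  have step: "v y = (2 * v y + v (y + 1) + v (y - 1)) / 4" if "y \<noteq> 0" for y
  proof -
    have "ennreal (v y) = (\<integral>\<^sup>+\<omega>. indicator (avoid y) \<omega> \<partial>srw_steps)"
      by (simp add: v_def S.emeasure_eq_measure)
    also have "\<dots> = (\<Sum>s\<in>unit_steps. \<integral>\<^sup>+\<omega>. indicator (avoid y) (case_nat s \<omega>) \<partial>srw_steps) / 4"
      by (rule nn_integral_first_step) measurable
    also have "\<dots> = (\<Sum>s\<in>unit_steps. \<integral>\<^sup>+\<omega>. indicator (avoid (y + snd s)) \<omega> \<partial>srw_steps) / 4"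
      by (simp add: indicator_def case_nat_in_avoid_iff that)
    also have "\<dots> = (\<Sum>s\<in>unit_steps. ennreal (v (y + snd s))) / 4"
      by (simp add: v_def S.emeasure_eq_measure)
    also have "\<dots> = ennreal ((\<Sum>s\<in>unit_steps. v (y + snd s)) / 4)"
      by (simp add: v_def divide_ennreal[symmetric] sum_nonneg)
    finally have "v y = (\<Sum>s\<in>unit_steps. v (y + snd s)) / 4"
      by (subst (asm) ennreal_inj) (auto simp: v_def sum_nonneg)
    then show ?thesis by (simp add: unit_steps_def algebra_simps)
  qed
  have bdd: "u 1 = 0" if lin: "\<And>n. u n = real n * u 1" and b: "\<And>n. 0 \<le> u n" "\<And>n. u n \<le> 1"
    for u :: "nat \<Rightarrow> real"
  proof (rule ccontr)
    assume "u 1 \<noteq> 0"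
    then have "u 1 > 0" using b(1)[of 1] by simp
    then obtain n where "1 < real n * u 1" using reals_Archimedean3 by blast
    then show False using lin[of n] b(2)[of n] by simp
  qed
  have lin1: "v (int n) = real n * v (int 1)" for n
  proof (rule linear_of_second_difference_zero)
    show "v (int (Suc (Suc n))) - v (int (Suc n)) = v (int (Suc n)) - v (int n)" for n
      using step[of "int (Suc n)"] by (simp add: algebra_simps)
  qed (simp add: v0)
  have lin2: "v (- int n) = real n * v (- int 1)" for n
  proof (rule linear_of_second_difference_zero)
    show "v (- int (Suc (Suc n))) - v (- int (Suc n)) = v (- int (Suc n)) - v (- int n)" for n
      using step[of "- int (Suc n)"] by (simp add: algebra_simps)
  qed (simp add: v0)
  have v01: "0 \<le> v y" "v y \<le> 1" for y
    by (simp_all add: v_def)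
  have "v (int 1) = 0" by (rule bdd[of "\<lambda>n. v (int n)", OF lin1 v01])
  moreover have "v (- int 1) = 0" by (rule bdd[of "\<lambda>n. v (- int n)", OF lin2 v01])
  ultimately have "v y = 0"
    using lin1[of "nat y"] lin2[of "nat (-y)"] by (cases "y \<ge> 0") auto
  then show ?thesis by (simp add: v_def)
qed

lemma AE_hits: "AE \<omega> in srw_steps. \<exists>n. y + srw_V \<omega> n = 0"
proof -
  interpret S: prob_space srw_steps by (rule prob_space_srw_steps)
  have "avoid y \<in> null_sets srw_steps"
    using measure_avoid[of y] by (auto simp: null_sets_def S.emeasure_eq_measure)
  then show ?thesis
    by (rule AE_I') (auto simp: avoid_def)
qed

section \<open>Superharmonic functions and the discrete Cauchy law\<close>

definition hitting_time :: "int \<Rightarrow> (nat \<Rightarrow> int \<times> int) \<Rightarrow> nat" where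
  "hitting_time y \<omega> = (LEAST n. y + srw_V \<omega> n = 0)"

text \<open>A walk started at \<^term>\<open>(x, y)\<close> collects \<^term>\<open>f\<close> of its abscissa where it first meets the axis, and
  nothing unless this happens within \<^term>\<open>k\<close> steps. The finite horizon is what makes an induction along
  the first step possible.\<close>
definition payoff :: "nat \<Rightarrow> (int \<Rightarrow> ennreal) \<Rightarrow> int \<Rightarrow> int \<Rightarrow> (nat \<Rightarrow> int \<times> int) \<Rightarrow> ennreal" where
  "payoff k f x y \<omega> =
     (if \<exists>n\<le>k. y + srw_V \<omega> n = 0 then f (x + srw_U \<omega> (hitting_time y \<omega>)) else 0)"

lemma measurable_hitting_position [measurable]:
  "(\<lambda>\<omega>. srw_U \<omega> (hitting_time y \<omega>)) \<in> measurable srw_steps (count_space UNIV)"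
proof -
  have T: "hitting_time y \<in> measurable srw_steps (count_space UNIV)"
    unfolding hitting_time_def by measurable
  show ?thesis
    by (rule measurable_compose_countable[OF _ T]) measurable
qed

lemma measurable_payoff [measurable]: "payoff k f x y \<in> borel_measurable srw_steps"
  unfolding payoff_def
proof (rule measurable_If)
  show "(\<lambda>\<omega>. f (x + srw_U \<omega> (hitting_time y \<omega>))) \<in> borel_measurable srw_steps"
    by (rule measurable_compose[OF measurable_hitting_position]) simp
  show "{\<omega> \<in> space srw_steps. \<exists>n\<le>k. y + srw_V \<omega> n = 0} \<in> sets srw_steps"
    by measurable
qed simp

lemma hitting_time_case_nat:
  assumes "y \<noteq> 0" and "\<exists>n. y + snd s + srw_V \<omega> n = 0"
  shows "hitting_time y (case_nat s \<omega>) = Suc (hitting_time (y + snd s) \<omega>)"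
proof -
  obtain n where n: "y + snd s + srw_V \<omega> n = 0" using assms(2) by blast
  have "(LEAST m. y + srw_V (case_nat s \<omega>) m = 0)
      = Suc (LEAST m. y + srw_V (case_nat s \<omega>) (Suc m) = 0)"
    by (rule Least_Suc[of _ "Suc n"]) (use n assms(1) in \<open>auto simp: srw_coordinates_case_nat\<close>)
  then show ?thesis
    by (simp add: hitting_time_def srw_coordinates_case_nat add.assoc)
qed

lemma payoff_case_nat:
  assumes "y \<noteq> 0"
  shows "payoff (Suc k) f x y (case_nat s \<omega>) = payoff k f (x + fst s) (y + snd s) \<omega>"
proof -
  have "(\<exists>n\<le>Suc k. y + srw_V (case_nat s \<omega>) n = 0) \<longleftrightarrow>
        (\<exists>n\<le>k. y + srw_V (case_nat s \<omega>) (Suc n) = 0)"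
    by (metis assms not0_implies_Suc srw_coordinates_0(2) add_0_right Suc_le_mono)
  then have *: "(\<exists>n\<le>Suc k. y + srw_V (case_nat s \<omega>) n = 0) \<longleftrightarrow> (\<exists>n\<le>k. y + snd s + srw_V \<omega> n = 0)"
    by (simp add: srw_coordinates_case_nat add.assoc)
  show ?thesis
  proof (cases "\<exists>n\<le>k. y + snd s + srw_V \<omega> n = 0")
    case True
    then have "hitting_time y (case_nat s \<omega>) = Suc (hitting_time (y + snd s) \<omega>)"
      by (intro hitting_time_case_nat[OF assms]) blast
    then show ?thesis
      using True unfolding payoff_def * by (simp add: srw_coordinates_case_nat add.assoc)
  next
    case False
    then show ?thesis by (simp only: payoff_def * if_not_P[OF False] if_False)
  qed
qed

text \<open>Optional stopping for a nonnegative supermartingale: along the walk, a function that is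
  superharmonic off the axis decreases on average until the axis is reached.\<close>
lemma nn_integral_payoff_le:
  fixes h :: "int \<Rightarrow> int \<Rightarrow> ennreal"
  assumes super: "\<And>x y. y \<noteq> 0 \<Longrightarrow> (\<Sum>s\<in>unit_steps. h (x + fst s) (y + snd s)) / 4 \<le> h x y"
  shows "(\<integral>\<^sup>+\<omega>. payoff k (\<lambda>x. h x 0) x y \<omega> \<partial>srw_steps) \<le> h x y"
proof -
  interpret S: prob_space srw_steps by (rule prob_space_srw_steps)
  have start: "(\<integral>\<^sup>+\<omega>. payoff k (\<lambda>x. h x 0) x 0 \<omega> \<partial>srw_steps) = h x 0" for k x
  proof -
    have "payoff k (\<lambda>x. h x 0) x 0 \<omega> = h x 0" for \<omega>
      by (auto simp: payoff_def hitting_time_def intro: exI[of _ 0])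
    then show ?thesis using S.emeasure_space_1 by simp
  qed
  show ?thesis
  proof (induction k arbitrary: x y)
    case 0
    show ?case
    proof (cases "y = 0")
      case False
      then have "payoff 0 (\<lambda>x. h x 0) x y \<omega> = 0" for \<omega>
        by (simp add: payoff_def)
      then show ?thesis by simp
    qed (simp add: start)
  next
    case (Suc k)
    show ?case
    proof (cases "y = 0")
      case False
      have "(\<integral>\<^sup>+\<omega>. payoff (Suc k) (\<lambda>x. h x 0) x y \<omega> \<partial>srw_steps) =
         (\<Sum>s\<in>unit_steps. \<integral>\<^sup>+\<omega>. payoff (Suc k) (\<lambda>x. h x 0) x y (case_nat s \<omega>) \<partial>srw_steps) / 4"
        by (rule nn_integral_first_step) measurable
      also have "\<dots> \<le> (\<Sum>s\<in>unit_steps. h (x + fst s) (y + snd s)) / 4"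
        unfolding payoff_case_nat[OF False]
        by (intro divide_right_mono_ennreal sum_mono Suc.IH)
      also have "\<dots> \<le> h x y" by (rule super[OF False])
      finally show ?thesis .
    qed (simp add: start)
  qed
qed

lemma srw_return_time_case_nat:
  assumes "\<exists>n. snd s + srw_V \<omega> n = 0"
  shows "srw_return_time (case_nat s \<omega>) = Suc (hitting_time (snd s) \<omega>)"
proof -
  obtain n where n: "snd s + srw_V \<omega> n = 0" using assms by blast
  have "(LEAST m. 0 < m \<and> srw_V (case_nat s \<omega>) m = 0)
      = Suc (LEAST m. 0 < Suc m \<and> srw_V (case_nat s \<omega>) (Suc m) = 0)"
    by (rule Least_Suc[of _ "Suc n"]) (use n in \<open>auto simp: srw_coordinates_case_nat\<close>)
  then show ?thesis
    by (simp add: hitting_time_def srw_return_time_def Inf_nat_def srw_coordinates_case_nat)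
qed

text \<open>A jump of law \<^const>\<open>P2\<close> is one planar step followed by the walk to its first visit of the axis.
  Recurrence allows the horizon in the preceding bound to go to infinity by monotone convergence.\<close>
theorem nn_integral_P2_le:
  fixes h :: "int \<Rightarrow> int \<Rightarrow> ennreal"
  assumes super: "\<And>x y. y \<noteq> 0 \<Longrightarrow> (\<Sum>s\<in>unit_steps. h (x + fst s) (y + snd s)) / 4 \<le> h x y"
  shows "(\<integral>\<^sup>+z. h (x + z) 0 \<partial>P2) \<le> (\<Sum>s\<in>unit_steps. h (x + fst s) (snd s)) / 4"
proof -
  let ?f = "\<lambda>x. h x 0"
  have lim: "(\<integral>\<^sup>+\<omega>. ?f (x + srw_U (case_nat s \<omega>) (srw_return_time (case_nat s \<omega>))) \<partial>srw_steps)
        \<le> h (x + fst s) (snd s)" for s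
  proof -
    have "(\<integral>\<^sup>+\<omega>. ?f (x + srw_U (case_nat s \<omega>) (srw_return_time (case_nat s \<omega>))) \<partial>srw_steps)
        = (\<integral>\<^sup>+\<omega>. (SUP k. payoff k ?f (x + fst s) (snd s) \<omega>) \<partial>srw_steps)"
    proof (rule nn_integral_cong_AE, use AE_hits[of "snd s"] in eventually_elim)
      fix \<omega> assume hit: "\<exists>n. snd s + srw_V \<omega> n = 0"
      then obtain n where n: "snd s + srw_V \<omega> n = 0" by blast
      let ?v = "?f (x + fst s + srw_U \<omega> (hitting_time (snd s) \<omega>))"
      have "(SUP k. payoff k ?f (x + fst s) (snd s) \<omega>) = ?v"
      proof (rule antisym)
        show "(SUP k. payoff k ?f (x + fst s) (snd s) \<omega>) \<le> ?v"
          by (rule SUP_least) (simp add: payoff_def)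
        show "?v \<le> (SUP k. payoff k ?f (x + fst s) (snd s) \<omega>)"
          by (rule SUP_upper2[of n]) (use n in \<open>auto simp: payoff_def\<close>)
      qed
      then show "?f (x + srw_U (case_nat s \<omega>) (srw_return_time (case_nat s \<omega>))) =
            (SUP k. payoff k ?f (x + fst s) (snd s) \<omega>)"
        by (simp add: srw_return_time_case_nat[OF hit] srw_coordinates_case_nat add.assoc)
    qed
    also have "\<dots> = (SUP k. \<integral>\<^sup>+\<omega>. payoff k ?f (x + fst s) (snd s) \<omega> \<partial>srw_steps)"
    proof (rule nn_integral_monotone_convergence_SUP)
      show "incseq (\<lambda>k. payoff k ?f (x + fst s) (snd s))"
        by (auto simp: incseq_def le_fun_def payoff_def intro: order_trans)
    qed measurable
    also have "\<dots> \<le> h (x + fst s) (snd s)"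
      by (rule SUP_least nn_integral_payoff_le[OF super])+
    finally show ?thesis .
  qed
  have m: "(\<lambda>\<omega>. ?f (x + srw_U \<omega> (srw_return_time \<omega>))) \<in> borel_measurable srw_steps"
    by (rule measurable_compose[OF measurable_srw_return_position]) simp
  have "(\<integral>\<^sup>+z. ?f (x + z) \<partial>P2) = (\<integral>\<^sup>+\<omega>. ?f (x + srw_U \<omega> (srw_return_time \<omega>)) \<partial>srw_steps)"
    unfolding P2_def by (subst nn_integral_distr) auto
  also have "\<dots> \<le> (\<Sum>s\<in>unit_steps. h (x + fst s) (snd s)) / 4"
    by (subst nn_integral_first_step[OF m]) (intro divide_right_mono_ennreal sum_mono lim)
  finally show ?thesis .
qed


section \<open>A logarithmic potential\<close>

text \<open>The family of test functions. Reflecting \<^term>\<open>y\<close> and shifting it by \<^term>\<open>B\<close> moves the singularity of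
  the logarithm to distance \<^term>\<open>B\<close> from the axis, so that on the axis the function is flat at scales below
  \<^term>\<open>B\<close> and logarithmic above. Subtracting \<^term>\<open>1 / 2 :: real\<close> makes it exactly superharmonic for the
  discrete Laplacian; the denominator normalises it to vanish at the origin.\<close>
definition log_pot :: "real \<Rightarrow> int \<Rightarrow> int \<Rightarrow> real" where
  "log_pot B x y = ln (((of_int x)\<^sup>2 + (\<bar>of_int y\<bar> + B)\<^sup>2 - 1/2) / (B\<^sup>2 - 1/2))"

text \<open>With $q = x^2 + y^2 - 1/2$ the four factors are $q + 1 \<plusminus> 2x$ and $q + 1 \<plusminus> 2y$, and the
  difference of the two sides is the square $4(x^2 - y^2)^2$. The constant $1/2$ is the one for which all
  other terms cancel. Taking logarithms, $\ln q$ is superharmonic on the lattice.\<close>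
lemma neighbour_product_le:
  fixes x y :: real
  shows "((x + 1)\<^sup>2 + y\<^sup>2 - 1/2) * ((x - 1)\<^sup>2 + y\<^sup>2 - 1/2) *
         ((x\<^sup>2 + (y + 1)\<^sup>2 - 1/2) * (x\<^sup>2 + (y - 1)\<^sup>2 - 1/2)) \<le> (x\<^sup>2 + y\<^sup>2 - 1/2) ^ 4"
proof -
  have "(x\<^sup>2 + y\<^sup>2 - 1/2) ^ 4 =
      ((x + 1)\<^sup>2 + y\<^sup>2 - 1/2) * ((x - 1)\<^sup>2 + y\<^sup>2 - 1/2) *
      ((x\<^sup>2 + (y + 1)\<^sup>2 - 1/2) * (x\<^sup>2 + (y - 1)\<^sup>2 - 1/2)) + 4 * (x\<^sup>2 - y\<^sup>2)\<^sup>2"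
    by (simp add: power2_eq_square power4_eq_xxxx field_simps)
  then show ?thesis by simp
qed

lemma one_le_square: "1 \<le> (B::real) \<Longrightarrow> 1 \<le> B\<^sup>2"
  by (simp add: power2_eq_square mult_ge1_I)

lemma log_pot_nonneg:
  assumes "1 \<le> B"
  shows "0 \<le> log_pot B x y"
proof -
  have "B\<^sup>2 \<le> (\<bar>of_int y\<bar> + B)\<^sup>2"
    using assms by (intro power_mono) auto
  then have "B\<^sup>2 - 1/2 \<le> (of_int x)\<^sup>2 + (\<bar>of_int y\<bar> + B)\<^sup>2 - 1/2"
    using zero_le_power2[of "of_int x :: real"] by linarith
  moreover have "0 < B\<^sup>2 - 1/2" using one_le_square[OF assms] by simp
  ultimately show ?thesis by (simp add: log_pot_def)
qed

lemma log_pot_altdef: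
  assumes "1 \<le> B"
  shows "log_pot B x y = ln ((of_int x)\<^sup>2 + (\<bar>of_int y\<bar> + B)\<^sup>2 - 1/2) - ln (B\<^sup>2 - 1/2)"
proof -
  have "B\<^sup>2 \<le> (\<bar>of_int y\<bar> + B)\<^sup>2"
    using assms by (intro power_mono) auto
  then have "0 < (of_int x)\<^sup>2 + (\<bar>of_int y\<bar> + B)\<^sup>2 - 1/2"
    using one_le_square[OF assms] zero_le_power2[of "of_int x :: real"] by linarith
  moreover have "0 < B\<^sup>2 - 1/2" using one_le_square[OF assms] by simp
  ultimately show ?thesis by (simp add: log_pot_def ln_div)
qed

lemma sum_unit_steps: "(\<Sum>s\<in>unit_steps. f s) = f (1, 0) + f (-1, 0) + f (0, 1) + (f (0, -1) :: 'a :: comm_monoid_add)"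
  by (simp add: unit_steps_def add.assoc)

lemma log_pot_superharmonic:
  assumes B: "1 \<le> B" and y: "y \<noteq> 0"
  shows "(\<Sum>s\<in>unit_steps. log_pot B (x + fst s) (y + snd s)) / 4 \<le> log_pot B x y"
proof -
  let ?x = "of_int x :: real"
  define Y where "Y = \<bar>of_int y :: real\<bar> + B"
  have "1 \<le> \<bar>y\<bar>" using y by linarith
  then have "1 \<le> \<bar>of_int y :: real\<bar>" by linarith
  then have Y: "2 \<le> Y" using B unfolding Y_def by linarith
  define a b c d q where abcd: "a = (?x + 1)\<^sup>2 + Y\<^sup>2 - 1/2" "b = (?x - 1)\<^sup>2 + Y\<^sup>2 - 1/2"
    "c = ?x\<^sup>2 + (Y + 1)\<^sup>2 - 1/2" "d = ?x\<^sup>2 + (Y - 1)\<^sup>2 - 1/2" "q = ?x\<^sup>2 + Y\<^sup>2 - 1/2"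
  have "1 \<le> Y\<^sup>2" "1 \<le> (Y + 1)\<^sup>2" "1 \<le> (Y - 1)\<^sup>2"
    using Y by (simp_all add: one_le_square)
  then have pos: "0 < a" "0 < b" "0 < c" "0 < d" "0 < q"
    unfolding abcd using zero_le_power2[of "?x + 1"] zero_le_power2[of "?x - 1"] zero_le_power2[of ?x]
    by linarith+
  have "a * b * (c * d) \<le> q ^ 4"
    unfolding abcd by (rule neighbour_product_le)
  then have "ln (a * b * (c * d)) \<le> ln (q ^ 4)"
    using pos by simp
  then have *: "ln a + ln b + ln c + ln d \<le> 4 * ln q"
    using pos by (simp add: ln_mult ln_realpow)
  have abs: "ln (?x\<^sup>2 + (\<bar>of_int (y + 1)\<bar> + B)\<^sup>2 - 1/2) + ln (?x\<^sup>2 + (\<bar>of_int (y - 1)\<bar> + B)\<^sup>2 - 1/2)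
      = ln c + ln d"
  proof (cases "y > 0")
    case True
    then have "\<bar>of_int (y + 1)\<bar> + B = Y + 1" "\<bar>of_int (y - 1)\<bar> + B = Y - 1"
      unfolding Y_def by linarith+
    then show ?thesis by (simp only: abcd)
  next
    case False
    then have "\<bar>of_int (y + 1)\<bar> + B = Y - 1" "\<bar>of_int (y - 1)\<bar> + B = Y + 1"
      using y unfolding Y_def by linarith+
    then show ?thesis by (simp only: abcd add.commute)
  qed
  show ?thesis
    using * abs by (simp add: sum_unit_steps log_pot_altdef[OF B] abcd Y_def[symmetric])
qed

text \<open>The unnormalised argument of the logarithm in \<^const>\<open>log_pot\<close> on the axis.\<close>
definition axis_q :: "real \<Rightarrow> int \<Rightarrow> real" where
  "axis_q B x = (of_int x)\<^sup>2 + B\<^sup>2 - 1/2"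

lemma axis_q_ge: "B\<^sup>2 - 1/2 \<le> axis_q B x"
  by (simp add: axis_q_def)

lemma axis_q_pos: "1 \<le> B \<Longrightarrow> 0 < axis_q B x"
  using axis_q_ge[of B x] one_le_square[of B] by linarith

text \<open>The product of the arguments at the two neighbours minus $q^2$ is $4B^2 - 1 - 2q$,
  which is at most
  $4q$ because $q \<ge> B^2 - 1/2$; then $\ln u - \ln v \<le> (u - v)/v$ applies.\<close>
lemma log_pot_horizontal_drift:
  assumes B: "1 \<le> B"
  shows "log_pot B (x + 1) 0 + log_pot B (x - 1) 0 \<le> 2 * log_pot B x 0 + 4 / axis_q B x"
proof -
  let ?x = "of_int x :: real"
  define q where "q = axis_q B x"
  have q: "0 < q" unfolding q_def by (rule axis_q_pos[OF B])
  have pos: "0 < (?x + 1)\<^sup>2 + B\<^sup>2 - 1/2" "0 < (?x - 1)\<^sup>2 + B\<^sup>2 - 1/2"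
    using axis_q_pos[OF B, of "x + 1"] axis_q_pos[OF B, of "x - 1"] by (simp_all add: axis_q_def)
  define p where "p = ((?x + 1)\<^sup>2 + B\<^sup>2 - 1/2) * ((?x - 1)\<^sup>2 + B\<^sup>2 - 1/2)"
  have p: "0 < p" unfolding p_def using pos by simp
  have "p - q\<^sup>2 = 4 * B\<^sup>2 - 1 - 2 * q"
    unfolding p_def q_def axis_q_def by (simp add: power2_eq_square field_simps)
  also have "\<dots> \<le> 4 * q"
    using axis_q_ge[of B x] one_le_square[OF B] unfolding q_def by linarith
  finally have "(p - q\<^sup>2) / q\<^sup>2 \<le> 4 * q / q\<^sup>2" by (rule divide_right_mono) simp
  then have "(p - q\<^sup>2) / q\<^sup>2 \<le> 4 / q" using q by (simp add: power2_eq_square)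
  then have "ln p - ln (q\<^sup>2) \<le> 4 / q"
    using ln_diff_le[of p "q\<^sup>2"] p q by simp
  then have "ln ((?x + 1)\<^sup>2 + B\<^sup>2 - 1/2) + ln ((?x - 1)\<^sup>2 + B\<^sup>2 - 1/2) - 2 * ln q \<le> 4 / q"
    using pos q unfolding p_def by (simp add: ln_mult ln_realpow)
  then show ?thesis
    by (simp add: log_pot_altdef[OF B] q_def axis_q_def)
qed

text \<open>The kink of \<^term>\<open>\<bar>y\<bar>\<close> at height zero is the only place where the function fails to be superharmonic.
  Its contribution is of order $B / (x^2 + B^2)$, the Cauchy kernel: summable over \<^term>\<open>x\<close> for fixed
  \<^term>\<open>B\<close>, and at most of order $1/B$.\<close>
lemma log_pot_axis_drift:
  assumes B: "1 \<le> B"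
  shows "(\<Sum>s\<in>unit_steps. log_pot B (x + fst s) (snd s)) / 4 \<le> log_pot B x 0 + (B + 2) / axis_q B x"
proof -
  let ?x = "of_int x :: real"
  define q where "q = axis_q B x"
  have q: "0 < q" unfolding q_def by (rule axis_q_pos[OF B])
  have e: "?x\<^sup>2 + (1 + B)\<^sup>2 - 1/2 = q + (2 * B + 1)"
    by (simp add: q_def axis_q_def power2_eq_square algebra_simps)
  have "ln (q + (2 * B + 1)) - ln q \<le> (2 * B + 1) / q"
    using ln_diff_le[of "q + (2 * B + 1)" q] q B by simp
  then have v: "log_pot B x 1 \<le> log_pot B x 0 + (2 * B + 1) / q" "log_pot B x (-1) \<le> log_pot B x 0 + (2 * B + 1) / q"
    using e by (simp_all add: log_pot_altdef[OF B] q_def axis_q_def)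
  have "(\<Sum>s\<in>unit_steps. log_pot B (x + fst s) (snd s))
      \<le> 4 * log_pot B x 0 + (4 / q + 2 * ((2 * B + 1) / q))"
    using v log_pot_horizontal_drift[OF B, of x, folded q_def]
    unfolding sum_unit_steps by (simp only: fst_conv snd_conv add_0_right diff_conv_add_uminus)
  also have "4 / q + 2 * ((2 * B + 1) / q) = 4 * ((B + 3 / 2) / q)"
    using q by (simp add: field_simps)
  also have "(B + 3 / 2) / q \<le> (B + 2) / q"
    using q by (intro divide_right_mono) auto
  finally have "(\<Sum>s\<in>unit_steps. log_pot B (x + fst s) (snd s)) \<le> 4 * (log_pot B x 0 + (B + 2) / q)"
    by (simp only: distrib_left)
  moreover have "a / 4 \<le> c" if "a \<le> 4 * c" for a c :: real
    using that by simp
  ultimately show ?thesis unfolding q_def by blast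
qed

lemma P2_drift:
  assumes B: "1 \<le> B"
  shows "(\<integral>\<^sup>+z. ennreal (log_pot B (x + z) 0) \<partial>P2) \<le> ennreal (log_pot B x 0 + (B + 2) / axis_q B x)"
proof -
  have e: "(\<Sum>s\<in>unit_steps. ennreal (f s)) / 4 = ennreal ((\<Sum>s\<in>unit_steps. f s) / 4)"
    if "\<And>s. 0 \<le> f s" for f
    using that by (simp add: divide_ennreal[symmetric] sum_nonneg)
  have "(\<integral>\<^sup>+z. ennreal (log_pot B (x + z) 0) \<partial>P2)
      \<le> (\<Sum>s\<in>unit_steps. ennreal (log_pot B (x + fst s) (snd s))) / 4"
  proof (rule nn_integral_P2_le)
    show "(\<Sum>s\<in>unit_steps. ennreal (log_pot B (x + fst s) (y + snd s))) / 4 \<le> ennreal (log_pot B x y)"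
      if "y \<noteq> 0" for x y
      by (subst e) (use that in \<open>auto intro!: ennreal_leI log_pot_superharmonic log_pot_nonneg B\<close>)
  qed
  also have "\<dots> = ennreal ((\<Sum>s\<in>unit_steps. log_pot B (x + fst s) (snd s)) / 4)"
    by (rule e) (rule log_pot_nonneg[OF B])
  also have "\<dots> \<le> ennreal (log_pot B x 0 + (B + 2) / axis_q B x)"
    by (rule ennreal_leI[OF log_pot_axis_drift[OF B]])
  finally show ?thesis .
qed

lemma P1_drift:
  assumes B: "1 \<le> B"
  shows "(\<integral>\<^sup>+z. ennreal (log_pot B (x + z) 0) \<partial>P1) \<le> ennreal (log_pot B x 0 + 2 / axis_q B x)"
proof -
  have "(\<integral>\<^sup>+z. ennreal (log_pot B (x + z) 0) \<partial>P1)
      = (ennreal (log_pot B (x + 1) 0) + ennreal (log_pot B (x - 1) 0)) / 2"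
    unfolding P1_def by (subst nn_integral_pmf_of_set) simp_all
  also have "\<dots> = ennreal ((log_pot B (x + 1) 0 + log_pot B (x - 1) 0) / 2)"
    by (simp add: divide_ennreal[symmetric] log_pot_nonneg B)
  also have "\<dots> \<le> ennreal (log_pot B x 0 + 2 / axis_q B x)"
    using log_pot_horizontal_drift[OF B, of x] by (intro ennreal_leI) simp
  finally show ?thesis .
qed

lemma log_pot_ge_ln2:
  assumes "1 \<le> B" "B \<le> \<bar>of_int x\<bar>"
  shows "ln 2 \<le> log_pot B x 0"
proof -
  have "B\<^sup>2 \<le> (of_int x)\<^sup>2" using assms by (metis abs_le_square_iff abs_of_nonneg order_trans zero_le_one)
  then have "2 * (B\<^sup>2 - 1/2) \<le> (of_int x)\<^sup>2 + B\<^sup>2 - 1/2" by simp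
  moreover have "0 < B\<^sup>2 - 1/2" using one_le_square[OF assms(1)] by simp
  ultimately show ?thesis
    by (simp add: log_pot_def pos_le_divide_eq)
qed


section \<open>Averaging the next jump\<close>

text \<open>On a countable type every integral is a sum over atoms, which reduces the disintegration below to
  elementary conditional probabilities.\<close>
lemma nn_integral_countable_measure:
  fixes N :: "'b :: countable measure"
  assumes N: "sets N = UNIV"
  shows "(\<integral>\<^sup>+x. F x \<partial>N) = (\<integral>\<^sup>+x. emeasure N {x} * F x \<partial>count_space UNIV)"
proof -
  have "density (count_space UNIV) (\<lambda>x. emeasure N {x}) = N"
  proof (rule measure_eqI_countable[of _ UNIV])
    show "emeasure (density (count_space UNIV) (\<lambda>x. emeasure N {x})) {a} = emeasure N {a}" for a
      by (subst emeasure_density) (auto simp: nn_integral_count_space_indicator[symmetric] nn_integral_count_space_finite)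
  qed (simp_all add: N)
  then have "(\<integral>\<^sup>+x. F x \<partial>N) = (\<integral>\<^sup>+x. F x \<partial>density (count_space UNIV) (\<lambda>x. emeasure N {x}))"
    by simp
  also have "\<dots> = (\<integral>\<^sup>+x. emeasure N {x} * F x \<partial>count_space UNIV)"
    by (rule nn_integral_density) simp_all
  finally show ?thesis .
qed

definition fresh :: "int list \<Rightarrow> bool" where
  "fresh l \<longleftrightarrow> last l \<notin> set (butlast l)"

definition jump_law :: "int list \<Rightarrow> int measure" where
  "jump_law l = (if fresh l then P2 else P1)"

lemma sets_jump_law [simp]: "sets (jump_law l) = UNIV"
  by (simp add: jump_law_def P2_def P1_def)

lemma measurable_jump_law [simp]:
  fixes f :: "int \<Rightarrow> ennreal"
  shows "f \<in> borel_measurable (jump_law l)"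
proof -
  have "borel_measurable (jump_law l) = (borel_measurable (count_space UNIV) :: (int \<Rightarrow> ennreal) set)"
    by (rule measurable_cong_sets) simp_all
  then show ?thesis by simp
qed

lemma prob_space_jump_law: "prob_space (jump_law l)"
  unfolding jump_law_def using prob_space_P2 prob_space_measure_pmf by (auto simp: P1_def)

text \<open>The past is recorded as a list of positions, so that it ranges over a countable type.\<close>
locale cauchy_bernoulli =
  fixes M :: "'a measure" and S :: "nat \<Rightarrow> 'a \<Rightarrow> int"
  assumes process: "cauchy_bernoulli_process M S"
begin

sublocale prob_space M
  using process by (simp add: cauchy_bernoulli_process_def)

lemma measurable_S [measurable]: "S n \<in> measurable M (count_space UNIV)"
  using process by (simp add: cauchy_bernoulli_process_def)

lemma AE_start: "AE \<omega> in M. S 0 \<omega> = 0"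
  using process by (simp add: cauchy_bernoulli_process_def)

definition path :: "nat \<Rightarrow> 'a \<Rightarrow> int list" where
  "path n \<omega> = map (\<lambda>i. S i \<omega>) [0..<Suc n]"

lemma path_0: "path 0 \<omega> = [S 0 \<omega>]"
  by (simp add: path_def)

lemma path_Suc: "path (Suc n) \<omega> = path n \<omega> @ [S (Suc n) \<omega>]"
  by (simp add: path_def)

lemma last_path: "last (path n \<omega>) = S n \<omega>"
  by (simp add: path_def)

lemma set_path: "set (path n \<omega>) = (\<lambda>i. S i \<omega>) ` {..n}"
  by (simp add: path_def atLeast0LessThan lessThan_Suc_atMost del: upt_Suc)

lemma path_eq_iff: "path n \<omega> = l \<longleftrightarrow> length l = Suc n \<and> (\<forall>i\<le>n. S i \<omega> = l ! i)"
proof -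
  have "path n \<omega> = l \<longleftrightarrow> length l = Suc n \<and> (\<forall>i<Suc n. path n \<omega> ! i = l ! i)"
    by (auto simp: list_eq_iff_nth_eq path_def simp del: upt_Suc)
  also have "\<dots> \<longleftrightarrow> length l = Suc n \<and> (\<forall>i\<le>n. S i \<omega> = l ! i)"
    by (auto simp: path_def less_Suc_eq_le simp del: upt_Suc)
  finally show ?thesis .
qed

lemma measurable_path [measurable]: "path n \<in> measurable M (count_space UNIV)"
proof -
  have "{\<omega>\<in>space M. path n \<omega> = l} \<in> sets M" for l
    unfolding path_eq_iff by measurable
  moreover have "path n -` {l} \<inter> space M = {\<omega>\<in>space M. path n \<omega> = l}" for l
    by auto
  ultimately have "path n -` {l} \<inter> space M \<in> sets M" for l
    by (simp only:)
  then show ?thesis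
    by (subst measurable_count_space_eq2_countable) auto
qed

lemma borel_measurable_of_path: "(\<lambda>\<omega>. F (path n \<omega>)) \<in> borel_measurable M"
  by (rule measurable_compose[OF measurable_path]) simp

lemma prob_path_jump:
  "measure M {\<omega>\<in>space M. path n \<omega> = l \<and> S (Suc n) \<omega> - S n \<omega> = z}
     = measure M {\<omega>\<in>space M. path n \<omega> = l} * measure (jump_law l) {z}"
proof (cases "measure M {\<omega>\<in>space M. path n \<omega> = l} > 0")
  case False
  then have 0: "measure M {\<omega>\<in>space M. path n \<omega> = l} = 0"
    using measure_nonneg[of M] by (metis less_eq_real_def)
  have "measure M {\<omega>\<in>space M. path n \<omega> = l \<and> S (Suc n) \<omega> - S n \<omega> = z}
      \<le> measure M {\<omega>\<in>space M. path n \<omega> = l}"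
    by (rule finite_measure_mono) auto
  then show ?thesis using 0 measure_nonneg[of M] by (simp add: antisym)
next
  case True
  have len: "length l = Suc n"
  proof (rule ccontr)
    assume "length l \<noteq> Suc n"
    then have "{\<omega>\<in>space M. path n \<omega> = l} = {}" by (simp add: path_eq_iff)
    then show False using True by (simp only: measure_empty less_irrefl)
  qed
  have ev: "path n \<omega> = l \<longleftrightarrow> (\<forall>i\<le>n. S i \<omega> = l ! i)" for \<omega>
    by (simp add: path_eq_iff len)
  have last: "last l = l ! n"
    using len by (cases "l = []") (simp_all add: last_conv_nth)
  have "set (butlast l) = (!) l ` {..<n}"
    using len nth_image[of n l] by (simp add: butlast_conv_take atLeast0LessThan)
  then have law: "(if l ! n \<notin> (!) l ` {..<n} then P2 else P1) = jump_law l"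
    by (simp add: jump_law_def fresh_def last)
  have "\<P>(\<omega> in M. \<forall>i\<le>n. S i \<omega> = l ! i) > 0"
    using True by (simp add: ev)
  then have "\<P>(\<omega> in M. S (Suc n) \<omega> - S n \<omega> \<in> {z} \<bar> \<forall>i\<le>n. S i \<omega> = l ! i)
      = measure (if l ! n \<notin> (!) l ` {..<n} then P2 else P1) {z}"
    using process unfolding cauchy_bernoulli_process_def by blast
  then have "\<P>(\<omega> in M. S (Suc n) \<omega> - S n \<omega> \<in> {z} \<and> path n \<omega> = l) / \<P>(\<omega> in M. path n \<omega> = l)
      = measure (jump_law l) {z}"
    unfolding law cond_prob_def ev .
  then have "\<P>(\<omega> in M. S (Suc n) \<omega> - S n \<omega> \<in> {z} \<and> path n \<omega> = l)
      = measure (jump_law l) {z} * \<P>(\<omega> in M. path n \<omega> = l)"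
    by (subst (asm) nonzero_divide_eq_eq) (use True in auto)
  then show ?thesis
    by (simp only: singleton_iff conj_commute mult.commute)
qed

text \<open>The form in which the transition rule is used: under the integral, the next jump may be averaged
  against its conditional law given the whole past.\<close>
lemma nn_integral_jump:
  "(\<integral>\<^sup>+\<omega>. f (path n \<omega>) (S (Suc n) \<omega> - S n \<omega>) \<partial>M)
     = (\<integral>\<^sup>+\<omega>. (\<integral>\<^sup>+z. f (path n \<omega>) z \<partial>jump_law (path n \<omega>)) \<partial>M)"
proof -
  let ?X = "\<lambda>\<omega>. (path n \<omega>, S (Suc n) \<omega> - S n \<omega>)"
  let ?P = "distr M (count_space UNIV) (path n)"
  let ?J = "distr M (count_space UNIV) ?X"
  have X: "?X \<in> measurable M (count_space UNIV)"
  proof -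
    have "{\<omega>\<in>space M. path n \<omega> = fst p \<and> S (Suc n) \<omega> - S n \<omega> = snd p} \<in> sets M" for p
      by measurable
    then have "{\<omega>\<in>space M. ?X \<omega> = p} \<in> sets M" for p
      by (simp only: prod_eq_iff fst_conv snd_conv)
    moreover have "?X -` {p} \<inter> space M = {\<omega>\<in>space M. ?X \<omega> = p}" for p
      by auto
    ultimately have "?X -` {p} \<inter> space M \<in> sets M" for p
      by (simp only:)
    then show ?thesis
      by (subst measurable_count_space_eq2_countable) (blast intro: countableI_type)+
  qed
  have J: "emeasure ?J {(l, z)} = emeasure ?P {l} * emeasure (jump_law l) {z}" for l z
  proof -
    interpret Q: prob_space "jump_law l" by (rule prob_space_jump_law)
    have "emeasure ?J {(l, z)} = emeasure M {\<omega>\<in>space M. path n \<omega> = l \<and> S (Suc n) \<omega> - S n \<omega> = z}"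
      using X by (subst emeasure_distr) (auto intro!: arg_cong[where f = "emeasure M"])
    moreover have "emeasure ?P {l} = emeasure M {\<omega>\<in>space M. path n \<omega> = l}"
      by (subst emeasure_distr) (auto intro!: arg_cong[where f = "emeasure M"])
    ultimately show ?thesis
      by (simp add: emeasure_eq_measure Q.emeasure_eq_measure prob_path_jump ennreal_mult)
  qed
  have "(\<integral>\<^sup>+\<omega>. f (path n \<omega>) (S (Suc n) \<omega> - S n \<omega>) \<partial>M) = (\<integral>\<^sup>+p. f (fst p) (snd p) \<partial>?J)"
    using X by (subst nn_integral_distr) auto
  also have "\<dots> = (\<integral>\<^sup>+p. emeasure ?J {p} * f (fst p) (snd p) \<partial>count_space UNIV)"
    by (rule nn_integral_countable_measure) simp
  also have "\<dots> = (\<integral>\<^sup>+l. \<integral>\<^sup>+z. emeasure ?J {(l, z)} * f l z \<partial>count_space UNIV \<partial>count_space UNIV)"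
    by (subst nn_integral_fst_count_space[symmetric]) simp
  also have "\<dots> = (\<integral>\<^sup>+l. emeasure ?P {l} * (\<integral>\<^sup>+z. f l z \<partial>jump_law l) \<partial>count_space UNIV)"
    unfolding J nn_integral_countable_measure[OF sets_jump_law] mult.assoc
    by (simp add: nn_integral_cmult)
  also have "\<dots> = (\<integral>\<^sup>+l. (\<integral>\<^sup>+z. f l z \<partial>jump_law l) \<partial>?P)"
    by (rule nn_integral_countable_measure[symmetric]) simp
  also have "\<dots> = (\<integral>\<^sup>+\<omega>. (\<integral>\<^sup>+z. f (path n \<omega>) z \<partial>jump_law (path n \<omega>)) \<partial>M)"
    by (subst nn_integral_distr) auto
  finally show ?thesis .
qed

end


section \<open>The range grows sublinearly\<close>

text \<open>Partial sums of the drift bound over arbitrary finite sets of sites are uniformly bounded, by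
  comparison with $\sum 1/n^2$ on each half-line.\<close>
lemma axis_q_summable_bound: "\<exists>G\<ge>0. \<forall>Y. finite Y \<longrightarrow> (\<Sum>x\<in>Y. 3 / axis_q 1 x) \<le> G"
proof -
  let ?a = "\<lambda>n::nat. 3 / axis_q 1 (int n)"
  have pos: "0 < axis_q 1 x" for x by (rule axis_q_pos) simp
  have "summable ?a"
  proof (rule summable_comparison_test_ev)
    show "summable (\<lambda>n. 3 * (1 / real n ^ 2))"
      by (intro summable_mult inverse_power_summable[of 2, simplified inverse_eq_divide]) simp
    show "eventually (\<lambda>n. norm (?a n) \<le> 3 * (1 / real n ^ 2)) sequentially"
      using eventually_gt_at_top[of 0]
    proof eventually_elim
      case (elim n)
      then show ?case using pos[of "int n"]
        by (simp add: axis_q_def abs_if divide_left_mono)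
    qed
  qed
  have half: "(\<Sum>n\<in>N. ?a n) \<le> suminf ?a" if "finite N" for N
    by (rule sum_le_suminf[OF \<open>summable ?a\<close> that]) (use pos in \<open>auto intro: less_imp_le\<close>)
  have "(\<Sum>x\<in>Y. 3 / axis_q 1 x) \<le> suminf ?a + suminf ?a" if Y: "finite Y" for Y
  proof -
    have split: "Y = {x\<in>Y. 0 \<le> x} \<union> {x\<in>Y. x < 0}" by auto
    have "(\<Sum>x\<in>Y. 3 / axis_q 1 x) = (\<Sum>x\<in>{x\<in>Y. 0 \<le> x}. 3 / axis_q 1 x) + (\<Sum>x\<in>{x\<in>Y. x < 0}. 3 / axis_q 1 x)"
      by (subst split, rule sum.union_disjoint) (use Y in auto)
    also have "(\<Sum>x\<in>{x\<in>Y. 0 \<le> x}. 3 / axis_q 1 x) = (\<Sum>n\<in>(\<lambda>x. nat \<bar>x\<bar>) ` {x\<in>Y. 0 \<le> x}. ?a n)"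
      by (subst sum.reindex) (auto simp: inj_on_def axis_q_def)
    also have "\<dots> \<le> suminf ?a" by (rule half) (use Y in simp)
    also have "(\<Sum>x\<in>{x\<in>Y. x < 0}. 3 / axis_q 1 x) = (\<Sum>n\<in>(\<lambda>x. nat \<bar>x\<bar>) ` {x\<in>Y. x < 0}. ?a n)"
      by (subst sum.reindex) (auto simp: inj_on_def axis_q_def)
    also have "\<dots> \<le> suminf ?a" by (rule half) (use Y in simp)
    finally show ?thesis by simp
  qed
  moreover have "0 \<le> suminf ?a" using half[of "{}"] by simp
  ultimately show ?thesis by (intro exI[of _ "suminf ?a + suminf ?a"]) simp
qed

text \<open>Sites far from the current position are counted by the logarithm, sites near it by the summable
  kernel.\<close>
lemma one_le_log_pot_plus_axis_q:
  assumes A: "0 < A"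
  shows "\<exists>C\<ge>0. \<forall>x. 1 \<le> log_pot 1 x 0 / A + C * (3 / axis_q 1 x)"
proof (intro exI[of _ "exp A"] conjI allI)
  fix x :: int
  let ?q = "axis_q 1 x"
  have q: "0 < ?q" by (rule axis_q_pos) simp
  have pot: "log_pot 1 x 0 = ln (2 * ?q)"
    by (simp add: log_pot_def axis_q_def field_simps)
  have nn: "0 \<le> log_pot 1 x 0 / A" using log_pot_nonneg[of 1 x 0] A by simp
  show "1 \<le> log_pot 1 x 0 / A + exp A * (3 / ?q)"
  proof (cases "A \<le> log_pot 1 x 0")
    case True
    then have "1 \<le> log_pot 1 x 0 / A" using A by (simp add: field_simps)
    moreover have "0 \<le> exp A * (3 / ?q)" using q by simp
    ultimately show ?thesis by linarith
  next
    case False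
    then have "2 * ?q \<le> exp A"
      unfolding pot using q by (metis exp_le_cancel_iff exp_ln linear mult_pos_pos zero_less_numeral)
    then have "1 \<le> exp A * (3 / ?q)" using q by (simp add: field_simps)
    then show ?thesis using nn by linarith
  qed
qed simp

context cauchy_bernoulli
begin

text \<open>The logarithmic potential, at the current position, of the set of sites visited so far.\<close>
definition pot_sum :: "nat \<Rightarrow> 'a \<Rightarrow> ennreal" where
  "pot_sum n \<omega> = (\<Sum>y\<in>set (path n \<omega>). ennreal (log_pot 1 (S n \<omega> - y) 0))"

lemma pot_sum_altdef:
  "pot_sum n \<omega> = (\<lambda>l. \<Sum>y\<in>set l. ennreal (log_pot 1 (last l - y) 0)) (path n \<omega>)"
  by (simp add: pot_sum_def last_path)

lemma measurable_pot_sum [measurable]: "pot_sum n \<in> borel_measurable M"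
  using borel_measurable_of_path[of "\<lambda>l. \<Sum>y\<in>set l. ennreal (log_pot 1 (last l - y) 0)" n]
  by (simp add: pot_sum_altdef[abs_def])

lemma jump_law_drift:
  assumes "1 \<le> B"
  shows "(\<integral>\<^sup>+z. ennreal (log_pot B (x + z) 0) \<partial>jump_law l)
       \<le> ennreal (log_pot B x 0) + ennreal ((if fresh l then B + 2 else 2) / axis_q B x)"
  using P2_drift[OF assms, of x] P1_drift[OF assms, of x] assms
  by (simp add: jump_law_def log_pot_nonneg axis_q_pos less_imp_le)

text \<open>One jump, of either law, increases the term of the site \<^term>\<open>y\<close> on average by at most the kernel
  evaluated at the distance to \<^term>\<open>y\<close>. Distinct sites give distinct differences, so that the increases add
  up to at most \<^term>\<open>G\<close>, however many sites have been visited; and a newly visited site enters with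
  potential zero.\<close>
lemma nn_integral_pot_sum:
  assumes G: "0 \<le> G" "\<And>Y. finite Y \<Longrightarrow> (\<Sum>x\<in>Y. 3 / axis_q 1 x) \<le> G"
  shows "(\<integral>\<^sup>+\<omega>. pot_sum n \<omega> \<partial>M) \<le> ennreal (real n * G)"
proof (induction n)
  case 0
  have "pot_sum 0 \<omega> = 0" for \<omega>
    by (simp add: pot_sum_def path_0 log_pot_def)
  then show ?case by simp
next
  case (Suc n)
  define f where "f l z = (\<Sum>y\<in>set l. ennreal (log_pot 1 (last l - y + z) 0))" for l z
  have zero: "log_pot 1 0 0 = 0" by (simp add: log_pot_def)
  have "pot_sum (Suc n) \<omega> = f (path n \<omega>) (S (Suc n) \<omega> - S n \<omega>)" for \<omega>
  proof -
    \<comment> \<open>A site visited for the first time contributes the value at zero distance, which is zero.\<close>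
    have "pot_sum (Suc n) \<omega> = (\<Sum>y\<in>set (path n \<omega>). ennreal (log_pot 1 (S (Suc n) \<omega> - y) 0))"
      unfolding pot_sum_def path_Suc
      by (rule sum.mono_neutral_right) (auto simp: zero)
    then show ?thesis by (simp add: f_def last_path algebra_simps)
  qed
  then have "(\<integral>\<^sup>+\<omega>. pot_sum (Suc n) \<omega> \<partial>M)
      = (\<integral>\<^sup>+\<omega>. (\<integral>\<^sup>+z. f (path n \<omega>) z \<partial>jump_law (path n \<omega>)) \<partial>M)"
    by (simp add: nn_integral_jump)
  also have "\<dots> \<le> (\<integral>\<^sup>+\<omega>. pot_sum n \<omega> + ennreal G \<partial>M)"
  proof (rule nn_integral_mono)
    fix \<omega>
    let ?l = "path n \<omega>"
    have "(\<integral>\<^sup>+z. f ?l z \<partial>jump_law ?l)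
        = (\<Sum>y\<in>set ?l. \<integral>\<^sup>+z. ennreal (log_pot 1 (last ?l - y + z) 0) \<partial>jump_law ?l)"
      unfolding f_def by (rule nn_integral_sum) simp
    also have "\<dots> \<le> (\<Sum>y\<in>set ?l. ennreal (log_pot 1 (last ?l - y) 0) + ennreal (3 / axis_q 1 (last ?l - y)))"
    proof (rule sum_mono)
      fix y
      have "(if fresh ?l then 1 + 2 else 2) / axis_q 1 (last ?l - y) \<le> 3 / axis_q 1 (last ?l - y)"
        using axis_q_pos[of 1 "last ?l - y"] by (intro divide_right_mono) auto
      then show "(\<integral>\<^sup>+z. ennreal (log_pot 1 (last ?l - y + z) 0) \<partial>jump_law ?l)
          \<le> ennreal (log_pot 1 (last ?l - y) 0) + ennreal (3 / axis_q 1 (last ?l - y))"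
        by (intro order_trans[OF jump_law_drift] add_left_mono ennreal_leI) auto
    qed
    also have "\<dots> = pot_sum n \<omega> + (\<Sum>y\<in>set ?l. ennreal (3 / axis_q 1 (last ?l - y)))"
      by (simp add: sum.distrib pot_sum_altdef)
    also have "(\<Sum>y\<in>set ?l. ennreal (3 / axis_q 1 (last ?l - y))) \<le> ennreal G"
    proof -
      have "(\<Sum>y\<in>set ?l. 3 / axis_q 1 (last ?l - y)) = (\<Sum>x\<in>(\<lambda>y. last ?l - y) ` set ?l. 3 / axis_q 1 x)"
        by (subst sum.reindex) (auto simp: inj_on_def)
      also have "\<dots> \<le> G" by (rule G(2)) simp
      finally have "ennreal (\<Sum>y\<in>set ?l. 3 / axis_q 1 (last ?l - y)) \<le> ennreal G"
        by (rule ennreal_leI)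
      moreover have "(\<Sum>y\<in>set ?l. ennreal (3 / axis_q 1 (last ?l - y)))
          = ennreal (\<Sum>y\<in>set ?l. 3 / axis_q 1 (last ?l - y))"
        by (rule sum_ennreal) (simp add: axis_q_pos less_imp_le)
      ultimately show ?thesis by (simp only:)
    qed
    finally show "(\<integral>\<^sup>+z. f ?l z \<partial>jump_law ?l) \<le> pot_sum n \<omega> + ennreal G"
      by (simp add: add_left_mono)
  qed
  also have "\<dots> = (\<integral>\<^sup>+\<omega>. pot_sum n \<omega> \<partial>M) + ennreal G"
    by (subst nn_integral_add) (simp_all add: emeasure_space_1)
  also have "\<dots> \<le> ennreal (real n * G) + ennreal G"
    by (rule add_right_mono[OF Suc.IH])
  also have "\<dots> = ennreal (real (Suc n) * G)"
    using G(1) by (simp add: ennreal_plus[symmetric] algebra_simps del: ennreal_plus)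
  finally show ?case .
qed

text \<open>A range of size \<^term>\<open>r\<close> has potential at least of order $A r$ for any fixed \<^term>\<open>A\<close>, up to
  a constant, because the logarithm is unbounded and only boundedly many sites are near the current
  position. The potential grows at most linearly, so \<^term>\<open>r\<close> is at most a small multiple of the time.\<close>
lemma expected_range_sublinear:
  assumes \<delta>: "0 < \<delta>"
  shows "\<exists>K\<ge>0. \<forall>n. (\<integral>\<^sup>+\<omega>. of_nat (card (set (path n \<omega>))) \<partial>M) \<le> ennreal (\<delta> * real n + K)"
proof -
  obtain G where G: "0 \<le> G" "\<And>Y. finite Y \<Longrightarrow> (\<Sum>x\<in>Y. 3 / axis_q 1 x) \<le> G"
    using axis_q_summable_bound by blast
  \<comment> \<open>The \<open>+ 1\<close> only keeps the threshold positive.\<close>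
  define A where "A = (G + 1) / \<delta>"
  have A: "0 < A" using G(1) \<delta> by (simp add: A_def)
  have AG: "G / A \<le> \<delta>" using G(1) \<delta> by (simp add: A_def field_simps)
  obtain C where C: "0 \<le> C" "\<And>x. 1 \<le> log_pot 1 x 0 / A + C * (3 / axis_q 1 x)"
    using one_le_log_pot_plus_axis_q[OF A] by blast
  have card: "of_nat (card (set (path n \<omega>))) \<le> ennreal (1 / A) * pot_sum n \<omega> + ennreal (C * G)" for n \<omega>
  proof -
    let ?V = "set (path n \<omega>)"
    have "real (card ?V) \<le> (\<Sum>y\<in>?V. log_pot 1 (S n \<omega> - y) 0 / A + C * (3 / axis_q 1 (S n \<omega> - y)))"
      using sum_mono[of ?V "\<lambda>_. 1", OF C(2)] by simp
    also have "\<dots> = 1 / A * (\<Sum>y\<in>?V. log_pot 1 (S n \<omega> - y) 0) + C * (\<Sum>y\<in>?V. 3 / axis_q 1 (S n \<omega> - y))"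
      by (simp add: sum.distrib sum_distrib_left sum_divide_distrib)
    also have "(\<Sum>y\<in>?V. 3 / axis_q 1 (S n \<omega> - y)) = (\<Sum>x\<in>(\<lambda>y. S n \<omega> - y) ` ?V. 3 / axis_q 1 x)"
      by (subst sum.reindex) (auto simp: inj_on_def)
    also have "\<dots> \<le> G" by (rule G(2)) simp
    finally have "real (card ?V) \<le> 1 / A * (\<Sum>y\<in>?V. log_pot 1 (S n \<omega> - y) 0) + C * G"
      using C(1) by (simp add: mult_left_mono)
    then have "ennreal (real (card ?V)) \<le> ennreal (1 / A * (\<Sum>y\<in>?V. log_pot 1 (S n \<omega> - y) 0) + C * G)"
      by (rule ennreal_leI)
    also have "\<dots> = ennreal (1 / A * (\<Sum>y\<in>?V. log_pot 1 (S n \<omega> - y) 0)) + ennreal (C * G)"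
      using A C(1) G(1) by (intro ennreal_plus mult_nonneg_nonneg sum_nonneg log_pot_nonneg) auto
    also have "ennreal (1 / A * (\<Sum>y\<in>?V. log_pot 1 (S n \<omega> - y) 0))
        = ennreal (1 / A) * ennreal (\<Sum>y\<in>?V. log_pot 1 (S n \<omega> - y) 0)"
      using A by (intro ennreal_mult') simp
    also have "ennreal (\<Sum>y\<in>?V. log_pot 1 (S n \<omega> - y) 0) = pot_sum n \<omega>"
      unfolding pot_sum_def by (subst sum_ennreal) (auto intro: log_pot_nonneg)
    finally show ?thesis by (simp add: ennreal_of_nat_eq_real_of_nat)
  qed
  have "(\<integral>\<^sup>+\<omega>. of_nat (card (set (path n \<omega>))) \<partial>M) \<le> ennreal (\<delta> * real n + C * G)" for n
  proof -
    have "(\<integral>\<^sup>+\<omega>. of_nat (card (set (path n \<omega>))) \<partial>M)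
        \<le> (\<integral>\<^sup>+\<omega>. ennreal (1 / A) * pot_sum n \<omega> + ennreal (C * G) \<partial>M)"
      by (rule nn_integral_mono) (rule card)
    also have "\<dots> = ennreal (1 / A) * (\<integral>\<^sup>+\<omega>. pot_sum n \<omega> \<partial>M) + ennreal (C * G)"
      by (subst nn_integral_add) (simp_all add: nn_integral_cmult emeasure_space_1)
    also have "\<dots> \<le> ennreal (1 / A) * ennreal (real n * G) + ennreal (C * G)"
      by (intro add_right_mono mult_left_mono nn_integral_pot_sum G zero_le)
    also have "\<dots> = ennreal (G / A * real n + C * G)"
      using A C(1) G(1) by (simp add: ennreal_mult'[symmetric] mult.commute)
    also have "\<dots> \<le> ennreal (\<delta> * real n + C * G)"
      using AG by (intro ennreal_leI add_right_mono mult_right_mono) auto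
    finally show ?thesis .
  qed
  moreover have "0 \<le> C * G" using C(1) G(1) by simp
  ultimately show ?thesis by blast
qed

section \<open>Exit from a large interval\<close>

text \<open>Once the path has left the interval, the potential is frozen at a lower bound for its value outside.
  The resulting functional plays the role of the process stopped at the exit time.\<close>
definition exit_pot :: "real \<Rightarrow> int list \<Rightarrow> ennreal" where
  "exit_pot B l = (if \<forall>y\<in>set l. \<bar>of_int y\<bar> < B then ennreal (log_pot B (last l) 0) else ennreal (ln 2))"

text \<open>Each step costs at most $4/B^2$, and only at a fresh site a further $6/B$. The fresh sites before
  time \<^term>\<open>n\<close> are counted by the range of the path without its last point.\<close>
lemma nn_integral_exit_pot:
  assumes B: "1 \<le> B"
  shows "(\<integral>\<^sup>+\<omega>. exit_pot B (path n \<omega>) \<partial>M)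
    \<le> ennreal (real n * (4 / B\<^sup>2)) + ennreal (6 / B) * (\<integral>\<^sup>+\<omega>. of_nat (card (set (butlast (path n \<omega>)))) \<partial>M)"
proof (induction n)
  case 0
  have "exit_pot B (path 0 \<omega>) = 0" if "S 0 \<omega> = 0" for \<omega>
  proof -
    have "B\<^sup>2 - 1/2 \<noteq> 0" using one_le_square[OF B] by linarith
    then show ?thesis using B that by (simp add: exit_pot_def path_0 log_pot_def)
  qed
  then have "(\<integral>\<^sup>+\<omega>. exit_pot B (path 0 \<omega>) \<partial>M) = (\<integral>\<^sup>+\<omega>. 0 \<partial>M)"
    by (intro nn_integral_cong_AE) (use AE_start in eventually_elim, simp)
  then show ?case by simp
next
  case (Suc n)
  have B2: "0 < B\<^sup>2" "B\<^sup>2 / 2 \<le> B\<^sup>2 - 1/2" using one_le_square[OF B] by linarith+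
  define f where "f l z = (if \<forall>y\<in>set l. \<bar>of_int y\<bar> < B
     then ennreal (log_pot B (last l + z) 0) else ennreal (ln 2))" for l z
  \<comment> \<open>If the path leaves the interval with this very jump, its potential there already exceeds the frozen value.\<close>
  have le_f: "exit_pot B (path (Suc n) \<omega>) \<le> f (path n \<omega>) (S (Suc n) \<omega> - S n \<omega>)" for \<omega>
    unfolding exit_pot_def f_def path_Suc
    using log_pot_ge_ln2[OF B, of "S (Suc n) \<omega>"] by (auto simp: last_path intro!: ennreal_leI)
  have drift: "(\<integral>\<^sup>+z. f l z \<partial>jump_law l)
      \<le> exit_pot B l + (ennreal (4 / B\<^sup>2) + ennreal (6 / B) * of_bool (fresh l))" for l
  proof (cases "\<forall>y\<in>set l. \<bar>of_int y\<bar> < B")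
    case True
    let ?q = "axis_q B (last l)"
    have q: "B\<^sup>2 / 2 \<le> ?q" using B2(2) axis_q_ge[of B "last l"] by linarith
    have q0: "0 < ?q" by (rule axis_q_pos[OF B])
    have "2 / ?q \<le> 2 / (B\<^sup>2 / 2)"
      by (rule divide_left_mono[OF q _ mult_pos_pos[OF q0]]) (use B2(1) in auto)
    then have 1: "2 / ?q \<le> 4 / B\<^sup>2" by simp
    have "(B + 2) / ?q \<le> (B + 2) / (B\<^sup>2 / 2)"
      by (rule divide_left_mono[OF q _ mult_pos_pos[OF q0]]) (use B B2(1) in auto)
    also have "\<dots> \<le> (3 * B) / (B\<^sup>2 / 2)"
      using B B2(1) by (intro divide_right_mono) auto
    also have "\<dots> = 6 / B" using B by (simp add: power2_eq_square)
    finally have 2: "(B + 2) / ?q \<le> 6 / B" .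
    have "ennreal ((if fresh l then B + 2 else 2) / ?q)
        \<le> ennreal (4 / B\<^sup>2) + ennreal (6 / B) * of_bool (fresh l)"
      using ennreal_leI[OF 1] ennreal_leI[OF 2] by (simp add: add_increasing)
    moreover have "(\<integral>\<^sup>+z. f l z \<partial>jump_law l) = (\<integral>\<^sup>+z. ennreal (log_pot B (last l + z) 0) \<partial>jump_law l)"
      using True by (simp add: f_def)
    ultimately show ?thesis
      using True by (auto simp: exit_pot_def intro: order_trans[OF jump_law_drift[OF B]] add_left_mono)
  next
    case False
    interpret Q: prob_space "jump_law l" by (rule prob_space_jump_law)
    have "(\<integral>\<^sup>+z. f l z \<partial>jump_law l) = (\<integral>\<^sup>+z. ennreal (ln 2) \<partial>jump_law l)"
      unfolding f_def if_not_P[OF False] ..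
    also have "\<dots> = ennreal (ln 2)" by (simp add: Q.emeasure_space_1)
    also have "\<dots> = exit_pot B l"
      unfolding exit_pot_def if_not_P[OF False] ..
    finally show ?thesis by simp
  qed
  have count: "card (set (path n \<omega>)) = card (set (butlast (path n \<omega>))) + of_bool (fresh (path n \<omega>))" for \<omega>
  proof -
    have "path n \<omega> = butlast (path n \<omega>) @ [last (path n \<omega>)]"
      by (simp add: path_def)
    then have "set (path n \<omega>) = insert (last (path n \<omega>)) (set (butlast (path n \<omega>)))"
      by (metis list.simps(15) Un_insert_right append.right_neutral empty_set set_append sup_bot.right_neutral)
    then show ?thesis by (simp add: fresh_def card_insert_if)
  qed
  have "(\<integral>\<^sup>+\<omega>. exit_pot B (path (Suc n) \<omega>) \<partial>M) \<le> (\<integral>\<^sup>+\<omega>. f (path n \<omega>) (S (Suc n) \<omega> - S n \<omega>) \<partial>M)"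
    by (rule nn_integral_mono) (rule le_f)
  also have "\<dots> = (\<integral>\<^sup>+\<omega>. (\<integral>\<^sup>+z. f (path n \<omega>) z \<partial>jump_law (path n \<omega>)) \<partial>M)"
    by (rule nn_integral_jump)
  also have "\<dots> \<le> (\<integral>\<^sup>+\<omega>. exit_pot B (path n \<omega>)
       + (ennreal (4 / B\<^sup>2) + ennreal (6 / B) * of_bool (fresh (path n \<omega>))) \<partial>M)"
    by (rule nn_integral_mono) (rule drift)
  also have "\<dots> = (\<integral>\<^sup>+\<omega>. exit_pot B (path n \<omega>) \<partial>M)
      + (ennreal (4 / B\<^sup>2) + ennreal (6 / B) * (\<integral>\<^sup>+\<omega>. of_bool (fresh (path n \<omega>)) \<partial>M))"
    by (simp add: nn_integral_add nn_integral_cmult borel_measurable_of_path emeasure_space_1)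
  also have "\<dots> \<le> (ennreal (real n * (4 / B\<^sup>2)) + ennreal (6 / B) * (\<integral>\<^sup>+\<omega>. of_nat (card (set (butlast (path n \<omega>)))) \<partial>M))
      + (ennreal (4 / B\<^sup>2) + ennreal (6 / B) * (\<integral>\<^sup>+\<omega>. of_bool (fresh (path n \<omega>)) \<partial>M))"
    by (rule add_right_mono[OF Suc.IH])
  also have "\<dots> = (ennreal (real n * (4 / B\<^sup>2)) + ennreal (4 / B\<^sup>2)) + ennreal (6 / B) *
      ((\<integral>\<^sup>+\<omega>. of_nat (card (set (butlast (path n \<omega>)))) \<partial>M) + (\<integral>\<^sup>+\<omega>. of_bool (fresh (path n \<omega>)) \<partial>M))"
    by (simp add: distrib_left add_ac)
  also have "ennreal (real n * (4 / B\<^sup>2)) + ennreal (4 / B\<^sup>2) = ennreal (real (Suc n) * (4 / B\<^sup>2))"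
    by (simp add: ennreal_plus[symmetric] distrib_right add_divide_distrib add.commute
        del: ennreal_plus)
  also have "(\<integral>\<^sup>+\<omega>. of_nat (card (set (butlast (path n \<omega>)))) \<partial>M) + (\<integral>\<^sup>+\<omega>. of_bool (fresh (path n \<omega>)) \<partial>M)
      = (\<integral>\<^sup>+\<omega>. of_nat (card (set (butlast (path (Suc n) \<omega>)))) \<partial>M)"
    by (subst nn_integral_add[symmetric])
      (auto simp: borel_measurable_of_path path_Suc count intro!: nn_integral_cong)
  finally show ?case .
qed

text \<open>Markov's inequality for the frozen potential, which equals \<^term>\<open>ln 2 :: real\<close> after the exit; this
  replaces both a truncation of the heavy-tailed jumps and a maximal inequality.\<close>
lemma exit_probability:
  assumes B: "1 \<le> B" and R: "(\<integral>\<^sup>+\<omega>. of_nat (card (set (path n \<omega>))) \<partial>M) \<le> ennreal R" "0 \<le> R"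
  shows "ln 2 * \<P>(\<omega> in M. \<exists>t\<le>n. B \<le> \<bar>of_int (S t \<omega>)\<bar>) \<le> 4 * real n / B\<^sup>2 + 6 * R / B"
proof -
  let ?E = "{\<omega>\<in>space M. \<exists>t\<le>n. B \<le> \<bar>of_int (S t \<omega>)\<bar>}"
  have E [measurable]: "?E \<in> sets M" by measurable
  have "ennreal (ln 2 * measure M ?E) = ennreal (ln 2) * emeasure M ?E"
    by (simp add: emeasure_eq_measure ennreal_mult)
  also have "\<dots> = (\<integral>\<^sup>+\<omega>. ennreal (ln 2) * indicator ?E \<omega> \<partial>M)"
    by (rule nn_integral_cmult_indicator[OF E, symmetric])
  also have "\<dots> \<le> (\<integral>\<^sup>+\<omega>. exit_pot B (path n \<omega>) \<partial>M)"
  proof (rule nn_integral_mono)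
    fix \<omega>
    show "ennreal (ln 2) * indicator ?E \<omega> \<le> exit_pot B (path n \<omega>)"
    proof (cases "\<omega> \<in> ?E")
      case True
      then have "\<not> (\<forall>y\<in>set (path n \<omega>). \<bar>of_int y\<bar> < B)"
        by (auto simp: set_path not_less)
      then have "exit_pot B (path n \<omega>) = ennreal (ln 2)"
        unfolding exit_pot_def by (rule if_not_P)
      then show ?thesis using True by simp
    qed simp
  qed
  also have "\<dots> \<le> ennreal (real n * (4 / B\<^sup>2)) + ennreal (6 / B) * (\<integral>\<^sup>+\<omega>. of_nat (card (set (butlast (path n \<omega>)))) \<partial>M)"
    by (rule nn_integral_exit_pot[OF B])
  also have "(\<integral>\<^sup>+\<omega>. of_nat (card (set (butlast (path n \<omega>)))) \<partial>M) \<le> (\<integral>\<^sup>+\<omega>. of_nat (card (set (path n \<omega>))) \<partial>M)"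
    by (intro nn_integral_mono of_nat_mono card_mono) (auto dest: in_set_butlastD)
  also have "\<dots> \<le> ennreal R" by (rule R(1))
  finally have "ennreal (ln 2 * measure M ?E) \<le> ennreal (real n * (4 / B\<^sup>2)) + ennreal (6 / B) * ennreal R"
    by (simp add: add_left_mono mult_left_mono)
  also have "\<dots> = ennreal (4 * real n / B\<^sup>2 + 6 * R / B)"
    using B R(2) by (simp add: ennreal_mult'[symmetric] mult.commute)
  finally show ?thesis
    using B R(2) by (subst (asm) ennreal_le_iff) auto
qed

end

section \<open>The weak law\<close>

theorem theorem3p1:
  fixes M :: "'a measure" and S :: "nat \<Rightarrow> 'a \<Rightarrow> int"
  assumes "cauchy_bernoulli_process M S"
  shows "tendsto_in_probability M
           (\<lambda>n \<omega>. (1 / real n) * (SUP t\<in>{..n}. \<bar>real_of_int (S t \<omega>)\<bar>)) (\<lambda>_. 0)"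
  unfolding tendsto_in_probability_def
proof (intro allI impI)
  interpret cauchy_bernoulli M S by standard (rule assms)
  fix \<epsilon> :: real assume \<epsilon>: "0 < \<epsilon>"
  let ?p = "\<lambda>n. \<P>(\<omega> in M. \<bar>1 / real n * (SUP t\<in>{..n}. \<bar>real_of_int (S t \<omega>)\<bar>) - 0\<bar> > \<epsilon>)"
  let ?e = "\<lambda>n. \<P>(\<omega> in M. \<exists>t\<le>n. \<epsilon> * real n \<le> \<bar>of_int (S t \<omega>)\<bar>)"
  have sup: "?p n \<le> ?e n" if n: "0 < n" for n
  proof (rule finite_measure_mono)
    show "{\<omega>\<in>space M. \<exists>t\<le>n. \<epsilon> * real n \<le> \<bar>of_int (S t \<omega>)\<bar>} \<in> sets M" by measurable
    show "{\<omega>\<in>space M. \<bar>1 / real n * (SUP t\<in>{..n}. \<bar>real_of_int (S t \<omega>)\<bar>) - 0\<bar> > \<epsilon>}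
        \<subseteq> {\<omega>\<in>space M. \<exists>t\<le>n. \<epsilon> * real n \<le> \<bar>of_int (S t \<omega>)\<bar>}"
    proof safe
      fix \<omega> assume gt: "\<bar>1 / real n * (SUP t\<in>{..n}. \<bar>real_of_int (S t \<omega>)\<bar>) - 0\<bar> > \<epsilon>"
      let ?A = "(\<lambda>t. \<bar>real_of_int (S t \<omega>)\<bar>) ` {..n}"
      have Sup: "Sup ?A = Max ?A" by (rule cSup_eq_Max) auto
      have "Max ?A \<in> ?A" by (rule Max_in) auto
      then have "\<exists>t\<in>{..n}. Max ?A = \<bar>real_of_int (S t \<omega>)\<bar>"
        by (rule imageE) (rule bexI)
      then obtain t where t: "t \<le> n" "Sup ?A = \<bar>real_of_int (S t \<omega>)\<bar>"
        unfolding Sup by (meson atMost_iff)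
      have "\<epsilon> * real n \<le> \<bar>of_int (S t \<omega>)\<bar>"
        using gt n unfolding t(2) by (simp add: field_simps)
      then show "\<exists>t\<le>n. \<epsilon> * real n \<le> \<bar>of_int (S t \<omega>)\<bar>" using t(1) by blast
    qed
  qed
  show "?p \<longlonglongrightarrow> 0"
  proof (rule LIMSEQ_I)
    fix \<eta> :: real assume \<eta>: "0 < \<eta>"
    \<comment> \<open>With \<open>B = \<epsilon> n\<close> this density of fresh sites contributes \<open>\<eta> / 2\<close> to the exit bound; the rest is \<open>c / n\<close>.\<close>
    define \<delta> where "\<delta> = \<eta> * \<epsilon> * ln 2 / 12"
    have \<delta>: "0 < \<delta>" using \<eta> \<epsilon> by (simp add: \<delta>_def)
    obtain K where K: "0 \<le> K"
      "\<And>n. (\<integral>\<^sup>+\<omega>. of_nat (card (set (path n \<omega>))) \<partial>M) \<le> ennreal (\<delta> * real n + K)"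
      using expected_range_sublinear[OF \<delta>] by blast
    define c where "c = (4 / \<epsilon>\<^sup>2 + 6 * K / \<epsilon>) / ln 2"
    obtain N where N: "1 / \<epsilon> < real N" "2 * c / \<eta> < real N"
      using reals_Archimedean2[of "max (1 / \<epsilon>) (2 * c / \<eta>)"] by auto
    have "?p n < \<eta>" if "max 1 N \<le> n" for n
    proof -
      have n: "0 < real n" "real N \<le> real n" using that by auto
      have "1 / \<epsilon> < real n" "2 * c / \<eta> < real n" using N n(2) by linarith+
      then have n1: "1 \<le> \<epsilon> * real n" and n2: "c / real n < \<eta> / 2"
        using \<epsilon> \<eta> n(1) by (simp_all add: field_simps)
      have "ln 2 * ?e n \<le> 4 * real n / (\<epsilon> * real n)\<^sup>2 + 6 * (\<delta> * real n + K) / (\<epsilon> * real n)"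
        by (rule exit_probability[OF n1 K(2)]) (use \<delta> K(1) in simp)
      also have "\<dots> = ln 2 * (c / real n + \<eta> / 2)"
        using n(1) \<epsilon> by (simp add: c_def \<delta>_def field_simps power2_eq_square)
      finally have "?e n \<le> c / real n + \<eta> / 2" by simp
      also have "\<dots> < \<eta>" using n2 by linarith
      finally have "?e n < \<eta>" .
      then show ?thesis using sup[of n] that by linarith
    qed
    then show "\<exists>no. \<forall>n\<ge>no. norm (?p n - 0) < \<eta>"
      by (intro exI[of _ "max 1 N"]) simp
  qed
qed

end
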